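(* A Minkowski plane $(M,\|\cdot\|)$ is Euclidean if and only if for any $\mathcal{C}$-orthocentric system $\{p_1,p_2,p_3,p_4\}$ (with $p_1,p_2,p_3$ non-collinear, so that the bisector below is defined), the equality $\|p_3-p_1\|=\|p_3-p_2\|$ holds whenever $p_4$ lies on the line containing the Busemann angular bisector $A_B\big([p_3,p_1\rangle,[p_3,p_2\rangle\big)$.
   Context: A Minkowski plane is a real two-dimensional normed linear space; it is Euclidean if its norm is induced by an inner product. For $x\neq y$, $[x,y\rangle$ denotes the ray with starting point $x$ passing through $y$. For non-collinear rays $[p,a\rangle$ and $[p,b\rangle$, the Busemann angular bisector $A_B([p,a\rangle,[p,b\rangle)$ is the ray $\left[p,\ p+\frac12\left(\frac{a-p}{\|a-p\|}+\frac{b-p}{\|b-p\|}\right)\right\rangle$. $S_p(w)=2p-w$ is the symmetry with center $p$. For points $a,b,c\in M$, the set of circumcenters is $\mathcal{C}(\triangle abc)=\{x\in M:\|x-a\|=\|x-b\|=\|x-c\|\}$. $\mathcal{C}$-orthocenter: given points $a,b,c\in M$ and $o\in\mathcal{C}(\triangle abc)$, put $q=\frac{a+b+c-o}{2}$, which is the point of symmetry between $\triangle abc$ and the triangle whose vertices are the images of $o$ under the symmetries at the midpoints of the sides $[b,c],[a,c],[a,b]$. The $\mathcal{C}$-orthocenter of $\triangle abc$ associated with $o$ is $S_q(o)=a+b+c-2o$. $\mathcal{C}$-orthocentric system: four points $p_1,p_2,p_3,p_4\in M$ form a $\mathcal{C}$-orthocentric system $\{p_1,p_2,p_3,p_4\}$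 if for some labeling $\{i,j,k,l\}=\{1,2,3,4\}$ there is a circumcenter $x_i\in\mathcal{C}(\triangle p_jp_kp_l)$ such that $p_i$ is the $\mathcal{C}$-orthocenter of $\triangle p_jp_kp_l$ associated with $x_i$.
   Formalization: The four points of a C-orthocentric system are required to be pairwise distinct; otherwise a Euclidean triangle with a right angle at p3 and unequal legs, where p4 = p3, is a counterexample. *)

theory Defs
  imports "HOL-Analysis.Analysis"
begin

definition inner_product_on_space :: "('a::real_vector \<Rightarrow> 'a \<Rightarrow> real) \<Rightarrow> bool" where
  "inner_product_on_space ip \<longleftrightarrow>
     bilinear ip \<and> (\<forall>x y. ip x y = ip y x) \<and> (\<forall>x. x \<noteq> 0 \<longrightarrow> ip x x > 0)"

definition euclidean_norm :: "('a::real_vector \<Rightarrow> real) \<Rightarrow> bool" where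
  "euclidean_norm N \<longleftrightarrow> (\<exists>ip. inner_product_on_space ip \<and> (\<forall>x. N x = sqrt (ip x x)))"

definition ray :: "'a::real_vector \<Rightarrow> 'a \<Rightarrow> 'a set" where
  "ray x y = {x + t *\<^sub>R (y - x) | t. t \<ge> 0}"

text \<open>
  \<open>busemann_bisector p a b\<close> is the bisector of the rays from \<open>p\<close> through \<open>a\<close> and through \<open>b\<close>.
  By \<open>busemann_bisector_cong\<close> below, it depends only on these rays and not on the points chosen
  on them.
\<close>

definition busemann_bisector :: "'a::real_normed_vector \<Rightarrow> 'a \<Rightarrow> 'a \<Rightarrow> 'a set" where
  "busemann_bisector p a b =
     ray p (p + (1/2) *\<^sub>R ((a - p) /\<^sub>R norm (a - p) + (b - p) /\<^sub>R norm (b - p)))"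

lemma ray_eq_imp_direction_eq:
  fixes p a a' :: "'a::real_normed_vector"
  assumes "a \<noteq> p" "ray p a = ray p a'"
  shows "(a - p) /\<^sub>R norm (a - p) = (a' - p) /\<^sub>R norm (a' - p)"
proof -
  have "a \<in> ray p a" unfolding ray_def by (auto intro!: exI[of _ 1])
  then obtain t where t: "t \<ge> 0" "a = p + t *\<^sub>R (a' - p)"
    using assms(2) unfolding ray_def by auto
  with assms(1) have "t > 0" by (cases "t = 0") auto
  moreover have "a - p = t *\<^sub>R (a' - p)" using t(2) by (simp add: algebra_simps)
  ultimately show ?thesis by simp
qed

lemma busemann_bisector_cong:
  fixes p a b a' b' :: "'a::real_normed_vector"
  assumes "a \<noteq> p" "b \<noteq> p" "ray p a = ray p a'" "ray p b = ray p b'"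
  shows "busemann_bisector p a b = busemann_bisector p a' b'"
  unfolding busemann_bisector_def
  using ray_eq_imp_direction_eq[OF assms(1,3)] ray_eq_imp_direction_eq[OF assms(2,4)] by simp

definition point_symmetry :: "'a::real_vector \<Rightarrow> 'a \<Rightarrow> 'a" where
  "point_symmetry p w = 2 *\<^sub>R p - w"

definition circumcenters :: "'a::real_normed_vector \<Rightarrow> 'a \<Rightarrow> 'a \<Rightarrow> 'a set" where
  "circumcenters a b c = {x. norm (x - a) = norm (x - b) \<and> norm (x - b) = norm (x - c)}"

text \<open>Only meaningful for \<open>z \<in> circumcenters a b c\<close>.\<close>

definition C_orthocenter :: "'a::real_vector \<Rightarrow> 'a \<Rightarrow> 'a \<Rightarrow> 'a \<Rightarrow> 'a" where
  "C_orthocenter a b c z = point_symmetry ((1/2) *\<^sub>R (a + b + c - z)) z"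

lemma C_orthocenter_eq: "C_orthocenter a b c z = a + b + c - 2 *\<^sub>R z"
  by (simp add: C_orthocenter_def point_symmetry_def scaleR_2)

text \<open>
  A system consists of four pairwise distinct points, hence the cardinality condition; a
  labeling is then the same as an enumeration \<open>P = {a, b, c, d}\<close>. Distinctness matters: in a
  Euclidean right triangle the orthocenter coincides with the vertex of the right angle, so it
  lies on the bisector at that vertex whatever the lengths of the legs.
\<close>

definition C_orthocentric_system :: "'a::real_normed_vector set \<Rightarrow> bool" where
  "C_orthocentric_system P \<longleftrightarrow>
     card P = 4 \<and>
     (\<exists>a b c d. P = {a, b, c, d} \<and> (\<exists>x \<in> circumcenters b c d. a = C_orthocenter b c d x))"

end

theory Submission
  imports Defs
begin

text \<open>
  For the nontrivial direction, let \<open>a\<close>, \<open>b\<close> be unit vectors. By the intermediate value theorem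
  some unit vector \<open>c\<close> on the arc from \<open>-a\<close> to \<open>-b\<close> has its bisector towards \<open>a\<close> and \<open>b\<close>
  parallel to \<open>a + b\<close>, that is, through the orthocenter \<open>a + b + c\<close>. The hypothesis forces
  \<open>c = -m\<close> with \<open>m = (a + b) / \<parallel>a + b\<parallel>\<close> and \<open>\<parallel>a + m\<parallel> = \<parallel>b + m\<parallel>\<close>. Renormalising
  \<open>a + m\<close>, \<open>b + m\<close> and iterating gives \<open>\<parallel>a + s m\<parallel> = \<parallel>b + s m\<parallel>\<close> for arbitrarily large \<open>s\<close>,
  and in the limit isosceles orthogonality implies Birkhoff orthogonality. Hence the norm has a
  unique minimum on every line missing the origin and is symmetric about it along the line, so
  linear maps interchanging two vectors of equal norm are isometries. Such maps carry one pair of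
  isosceles orthogonal unit vectors to every unit vector, which pins down the unit circle.
\<close>

section \<open>From equal sides to Birkhoff orthogonality\<close>

text \<open>With \<open>m\<close> the normalised sum, this is the equality of sides at the vertex
  \<open>-m\<close> of the triangle \<open>a\<close>, \<open>b\<close>, \<open>-m\<close>, which has
  the origin as a circumcenter. The \<open>itself\<close> argument turns a statement about the whole
  norm into a hypothesis that later lemmas can carry.\<close>

definition bisecting_property :: "'a::real_normed_vector itself \<Rightarrow> bool" where
  "bisecting_property _ \<longleftrightarrow>
    (\<forall>a b :: 'a. norm a = 1 \<longrightarrow> norm b = 1 \<longrightarrow> a + b \<noteq> 0 \<longrightarrow>
       norm (a + (a + b) /\<^sub>R norm (a + b)) = norm (b + (a + b) /\<^sub>R norm (a + b)))"

definition isosceles_imp_birkhoff :: "'a::real_normed_vector itself \<Rightarrow> bool" where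
  "isosceles_imp_birkhoff _ \<longleftrightarrow>
    (\<forall>(x::'a) y t. norm (x + y) = norm (x - y) \<longrightarrow> norm x \<le> norm (x + t *\<^sub>R y))"

text \<open>Convexity along a line: with \<open>z\<close> = \<open>y\<close> or \<open>-y\<close>
  and \<open>u\<close> = \<bar>t\<bar>, the point \<open>x + r z\<close> is a convex combination of
  \<open>x - r z\<close> and \<open>x + u z\<close>, and the first of these has the same norm as
  \<open>x + r z\<close>.\<close>

lemma norm_line_le_of_equal_values:
  fixes x y :: "'a::real_normed_vector"
  assumes eq: "norm (x + r *\<^sub>R y) = norm (x - r *\<^sub>R y)" and "0 < r" "r \<le> \<bar>t\<bar>"
  shows "norm (x + r *\<^sub>R y) \<le> norm (x + t *\<^sub>R y)"
proof -
  define z where "z = (if t > 0 then y else - y)"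
  have eqz: "norm (x + r *\<^sub>R z) = norm (x - r *\<^sub>R z)" using eq by (auto simp: z_def)
  define u where "u = \<bar>t\<bar>"
  have u: "u > 0" "u \<ge> r" using assms by (auto simp: u_def)
  have tz: "t *\<^sub>R y = u *\<^sub>R z" by (auto simp: z_def u_def)
  have "(u + r) *\<^sub>R (x + r *\<^sub>R z) = (u - r) *\<^sub>R (x - r *\<^sub>R z) + (r + r) *\<^sub>R (x + u *\<^sub>R z)"
    by (simp only: scaleR_right_distrib scaleR_right_diff_distrib scaleR_left_distrib
        scaleR_left_diff_distrib) (simp add: algebra_simps)
  then have "norm ((u + r) *\<^sub>R (x + r *\<^sub>R z)) \<le>
      norm ((u - r) *\<^sub>R (x - r *\<^sub>R z)) + norm ((r + r) *\<^sub>R (x + u *\<^sub>R z))"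
    by (metis norm_triangle_ineq)
  then have "(u + r) * norm (x + r *\<^sub>R z) \<le>
      (u - r) * norm (x + r *\<^sub>R z) + (r + r) * norm (x + u *\<^sub>R z)"
    using u assms(2) eqz by simp
  then have "(r + r) * norm (x + r *\<^sub>R z) \<le> (r + r) * norm (x + u *\<^sub>R z)"
    by (simp add: algebra_simps)
  then have "norm (x + r *\<^sub>R z) \<le> norm (x + u *\<^sub>R z)" using assms(2) by simp
  moreover have "norm (x + r *\<^sub>R z) = norm (x + r *\<^sub>R y)" using eq by (auto simp: z_def)
  ultimately show ?thesis by (simp add: tz)
qed

text \<open>Dividing \<open>a + s m\<close> and \<open>b + s m\<close> by their common norm
  \<open>r\<close> gives unit vectors whose sum is still a positive multiple of \<open>m\<close>.
  The bisecting property then adds \<open>m\<close> to both, and scaling back replaces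
  \<open>s\<close> by \<open>s + r\<close>.\<close>

lemma bisecting_step:
  fixes a b m :: "'a::real_normed_vector"
  assumes bp: "bisecting_property TYPE('a)"
    and m: "norm m = 1" "a + b = k *\<^sub>R m" "k > 0" and "s \<ge> 0"
    and eq: "norm (a + s *\<^sub>R m) = norm (b + s *\<^sub>R m)"
  shows "\<exists>s'\<ge>s + k / 2. norm (a + s' *\<^sub>R m) = norm (b + s' *\<^sub>R m)"
proof -
  define r where "r = norm (a + s *\<^sub>R m)"
  have sum: "(a + s *\<^sub>R m) + (b + s *\<^sub>R m) = (k + 2 * s) *\<^sub>R m"
  proof -
    have "(a + s *\<^sub>R m) + (b + s *\<^sub>R m) = (a + b) + (2 * s) *\<^sub>R m"
      by (simp add: algebra_simps scaleR_2 flip: scaleR_scaleR)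
    then show ?thesis by (simp add: m(2) algebra_simps)
  qed
  \<comment> \<open>The triangle inequality bounds \<open>r\<close> below by
    \<open>s + k / 2\<close>, so each step gains at least the fixed amount
    \<open>k / 2\<close>.\<close>
  have "norm ((k + 2 * s) *\<^sub>R m) \<le> r + r"
    using norm_triangle_ineq[of "a + s *\<^sub>R m" "b + s *\<^sub>R m"] eq unfolding sum r_def by simp
  then have r: "r \<ge> s + k / 2" using m assms(5) by simp
  then have r0: "r > 0" using m assms(5) by simp
  define a' b' where "a' = (a + s *\<^sub>R m) /\<^sub>R r" and "b' = (b + s *\<^sub>R m) /\<^sub>R r"
  have n: "norm a' = 1" "norm b' = 1" using r0 eq by (auto simp: a'_def b'_def r_def)
  have s': "a' + b' = ((k + 2 * s) / r) *\<^sub>R m"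
    unfolding a'_def b'_def using sum by (simp flip: scaleR_right_distrib add: divide_inverse_commute)
  define c where "c = (k + 2 * s) / r"
  have c: "c > 0" "a' + b' = c *\<^sub>R m" using s' m assms(5) r0 by (simp_all add: c_def)
  then have "a' + b' \<noteq> 0" using m by auto
  moreover have "(a' + b') /\<^sub>R norm (a' + b') = m" using c m by simp
  ultimately have "norm (a' + m) = norm (b' + m)"
    using bp n unfolding bisecting_property_def by metis
  then have "norm (r *\<^sub>R (a' + m)) = norm (r *\<^sub>R (b' + m))" by simp
  moreover have "r *\<^sub>R (a' + m) = a + (s + r) *\<^sub>R m" "r *\<^sub>R (b' + m) = b + (s + r) *\<^sub>R m"
    using r0 by (auto simp: a'_def b'_def algebra_simps)
  ultimately show ?thesis using r assms(5) by (intro exI[of _ "s + r"]) auto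
qed

text \<open>Since \<open>a\<close> and \<open>b\<close> are the halves of \<open>k m + e\<close> and
  \<open>k m - e\<close>, dividing \<open>a + s m\<close> and \<open>b + s m\<close> by
  \<open>w = s + k / 2\<close> gives \<open>m + r e\<close> and \<open>m - r e\<close> with
  \<open>r = 1 / (2 w)\<close>. Equal norms for arbitrarily large \<open>s\<close> thus mean equal
  norms at arbitrarily small distance on both sides of \<open>m\<close>, and convexity makes
  \<open>m\<close> a minimizer.\<close>

lemma bisecting_imp_birkhoff_unit:
  fixes a b :: "'a::real_normed_vector"
  assumes bp: "bisecting_property TYPE('a)" and ab: "norm a = 1" "norm b = 1"
  shows "norm (a + b) \<le> norm (a + b + t *\<^sub>R (a - b))"
proof (cases "a + b = 0 \<or> t = 0")
  case False
  define k where "k = norm (a + b)"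
  define m where "m = (a + b) /\<^sub>R k"
  define e where "e = a - b"
  have k: "k > 0" using False by (simp add: k_def)
  have m: "norm m = 1" "a + b = k *\<^sub>R m" using k by (auto simp: m_def k_def)
  have large: "\<exists>s\<ge>real n * (k / 2). norm (a + s *\<^sub>R m) = norm (b + s *\<^sub>R m)" for n
  proof (induction n)
    case 0
    show ?case using ab by (intro exI[of _ 0]) auto
  next
    case (Suc n)
    then obtain s where s: "s \<ge> real n * (k / 2)" "norm (a + s *\<^sub>R m) = norm (b + s *\<^sub>R m)"
      by blast
    then have "s \<ge> 0" using k
      by (meson mult_nonneg_nonneg of_nat_0_le_iff order_trans half_gt_zero less_imp_le)
    from bisecting_step[OF bp m k this s(2)] obtain s' where
      "s' \<ge> s + k / 2" "norm (a + s' *\<^sub>R m) = norm (b + s' *\<^sub>R m)" by blast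
    then show ?case using s(1) by (intro exI[of _ s']) (auto simp: algebra_simps add_divide_distrib)
  qed
  have key: "1 \<le> norm (m + u *\<^sub>R e)" if "u \<noteq> 0" for u
  proof (rule field_le_epsilon)
    fix \<epsilon> :: real
    assume \<epsilon>: "\<epsilon> > 0"
    \<comment> \<open>The two entries of the maximum yield \<open>r\<close> \<le> \<bar>u\<bar> and
      \<open>r * norm e\<close> \<le> \<epsilon>; the added 1 keeps \<open>W\<close>
      positive.\<close>
    define W where "W = max (1 / \<bar>u\<bar>) (norm e / \<epsilon>) + 1"
    obtain n where n: "real n * (k / 2) > W" using k ex_less_of_nat_mult[of "k / 2" W] by auto
    obtain s where s: "s \<ge> real n * (k / 2)" "norm (a + s *\<^sub>R m) = norm (b + s *\<^sub>R m)"
      using large by blast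
    define w where "w = s + k / 2"
    have w: "w > W" using n s k by (simp add: w_def)
    have W0: "W > 0" by (simp add: W_def add_nonneg_pos le_max_iff_disj)
    have "2 *\<^sub>R a = k *\<^sub>R m + e" "2 *\<^sub>R b = k *\<^sub>R m - e"
      unfolding m(2)[symmetric] e_def by (auto simp: scaleR_2)
    then have ab2: "a = (1/2) *\<^sub>R (k *\<^sub>R m + e)" "b = (1/2) *\<^sub>R (k *\<^sub>R m - e)"
      by (metis scaleR_half_double scaleR_2)+
    define r where "r = 1 / (2 * w)"
    have "a + s *\<^sub>R m = w *\<^sub>R (m + r *\<^sub>R e)" "b + s *\<^sub>R m = w *\<^sub>R (m - r *\<^sub>R e)"
      using w W0 unfolding ab2 w_def r_def by (auto simp: algebra_simps)
    then have eq: "norm (m + r *\<^sub>R e) = norm (m - r *\<^sub>R e)" using s(2) w W0 by simp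
    have r0: "r > 0" using w W0 by (simp add: r_def)
    have w1: "w > 1 / \<bar>u\<bar>" and w2: "w > norm e / \<epsilon>" using w by (auto simp: W_def)
    have "1 < w * \<bar>u\<bar>" using w1 that by (simp add: field_simps)
    then have ru: "r \<le> \<bar>u\<bar>" using w W0 by (simp add: r_def field_simps)
    have "norm e \<le> w * \<epsilon>" using w2 \<epsilon> by (simp add: field_simps)
    also have "\<dots> \<le> 2 * w * \<epsilon>" using w W0 \<epsilon> by simp
    finally have re: "r * norm e \<le> \<epsilon>" using w W0 by (simp add: r_def field_simps)
    have "1 \<le> norm (m + r *\<^sub>R e) + r * norm e"
      using norm_triangle_ineq4[of "m + r *\<^sub>R e" "r *\<^sub>R e"] m r0 by simp
    also have "\<dots> \<le> norm (m + u *\<^sub>R e) + \<epsilon>"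
      using norm_line_le_of_equal_values[OF eq r0 ru] re by simp
    finally show "1 \<le> norm (m + u *\<^sub>R e) + \<epsilon>" .
  qed
  have "a + b + t *\<^sub>R (a - b) = k *\<^sub>R (m + (t / k) *\<^sub>R e)"
    using k m(2) by (simp add: e_def scaleR_right_distrib)
  then have "norm (a + b + t *\<^sub>R (a - b)) = k * norm (m + (t / k) *\<^sub>R e)" using k by simp
  then show ?thesis using key[of "t / k"] k False by (simp add: k_def)
qed auto

lemma isosceles_imp_birkhoff_if_bisecting:
  assumes bp: "bisecting_property TYPE('a::real_normed_vector)"
  shows "isosceles_imp_birkhoff TYPE('a)"
  unfolding isosceles_imp_birkhoff_def
proof (intro allI impI)
  fix x y :: 'a and t
  assume eq: "norm (x + y) = norm (x - y)"
  define r where "r = norm (x + y)"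
  show "norm x \<le> norm (x + t *\<^sub>R y)"
  proof (cases "r = 0")
    case True
    then have "x + y = 0" "x - y = 0" using eq by (auto simp: r_def)
    then have "(x + y) + (x - y) = 0" by simp
    then have "2 *\<^sub>R x = 0" by (simp add: scaleR_2)
    then show ?thesis by simp
  next
    case False
    then have r: "r > 0" by (simp add: r_def)
    define a b where "a = (x + y) /\<^sub>R r" and "b = (x - y) /\<^sub>R r"
    have n: "norm a = 1" "norm b = 1" using r eq by (auto simp: a_def b_def r_def)
    have s: "a + b = (2 / r) *\<^sub>R x" "a - b = (2 / r) *\<^sub>R y"
      by (auto simp: a_def b_def divide_inverse_commute scaleR_2 algebra_simps simp flip: scaleR_scaleR)
    have "norm ((2 / r) *\<^sub>R x) \<le> norm ((2 / r) *\<^sub>R (x + t *\<^sub>R y))"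
      using bisecting_imp_birkhoff_unit[OF bp n, of t] unfolding s by (simp add: algebra_simps)
    then show ?thesis using r by (simp add: divide_simps)
  qed
qed


section \<open>Uniqueness of the nearest point on a line\<close>

lemma norm_flat_cone:
  fixes x y :: "'a::real_normed_vector"
  assumes flat: "\<And>t. \<bar>t\<bar> \<le> 1 \<Longrightarrow> norm (x + t *\<^sub>R y) = \<mu>" and "\<alpha> > 0" "\<bar>\<beta>\<bar> \<le> \<alpha>"
  shows "norm (\<alpha> *\<^sub>R x + \<beta> *\<^sub>R y) = \<alpha> * \<mu>"
proof -
  have "\<alpha> *\<^sub>R x + \<beta> *\<^sub>R y = \<alpha> *\<^sub>R (x + (\<beta> / \<alpha>) *\<^sub>R y)"
    using assms(2) by (simp add: algebra_simps)
  then show ?thesis using flat[of "\<beta> / \<alpha>"] assms(2,3) by simp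
qed

text \<open>
  If the norm exceeded \<open>\<mu>\<close> at \<open>x + (3/2) y\<close>, the chord of a sphere through the directions of
  \<open>x\<close> and \<open>x + (3/2) y\<close> would have its midpoint in the cone over the flat piece, where the norm
  is linear and not constant along the chord.
\<close>

lemma birkhoff_flat_extends:
  fixes x y :: "'a::real_normed_vector"
  assumes ib: "isosceles_imp_birkhoff TYPE('a)" and "\<mu> > 0"
    and flat: "\<And>t. \<bar>t\<bar> \<le> 1 \<Longrightarrow> norm (x + t *\<^sub>R y) = \<mu>"
  shows "norm (x + (3/2) *\<^sub>R y) \<le> \<mu>"
proof (rule ccontr)
  define M where "M = norm (x + (3/2) *\<^sub>R y)"
  assume "\<not> norm (x + (3/2) *\<^sub>R y) \<le> \<mu>"
  then have M: "M > \<mu>" by (simp add: M_def)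
  define a b where "a = M *\<^sub>R x" and "b = \<mu> *\<^sub>R (x + (3/2) *\<^sub>R y)"
  have "norm a = norm b"
    using flat[of 0] M assms(2) by (simp add: a_def b_def M_def)
  moreover have "(a + b) + (a - b) = 2 *\<^sub>R a" "(a + b) - (a - b) = 2 *\<^sub>R b"
    by (simp_all add: scaleR_2)
  ultimately have "norm ((a + b) + (a - b)) = norm ((a + b) - (a - b))" by simp
  \<comment> \<open>The factor -1/3 moves from \<open>a + b\<close> towards the direction of
    \<open>b\<close>, to 2/3 \<open>a\<close> + 4/3 \<open>b\<close>. This point is still in the
    cone over the flat piece because \<mu> < \<open>M\<close>, and by linearity of the norm there it
    is shorter than \<open>a + b\<close>.\<close>
  then have "norm (a + b) \<le> norm ((a + b) + (- (1/3)) *\<^sub>R (a - b))"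
    using ib unfolding isosceles_imp_birkhoff_def by blast
  also have "(a + b) + (- (1/3)) *\<^sub>R (a - b) =
      ((2 * M + 4 * \<mu>) / 3) *\<^sub>R x + (2 * \<mu>) *\<^sub>R y"
  proof -
    have "(a + b) + (- (1/3)) *\<^sub>R (a - b) = (2/3) *\<^sub>R a + (4/3) *\<^sub>R b"
      using scaleR_left_distrib[of 1 "1/3" b] scaleR_left_diff_distrib[of 1 "1/3" a]
      by (simp add: algebra_simps)
    also have "\<dots> = ((2 * M + 4 * \<mu>) / 3) *\<^sub>R x + (2 * \<mu>) *\<^sub>R y"
      by (simp add: a_def b_def add_divide_distrib algebra_simps)
    finally show ?thesis .
  qed
  also have "norm \<dots> = (2 * M + 4 * \<mu>) / 3 * \<mu>"
    using M assms(2) by (intro norm_flat_cone flat) auto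
  also have "a + b = (M + \<mu>) *\<^sub>R x + (3/2 * \<mu>) *\<^sub>R y"
    by (simp add: a_def b_def algebra_simps)
  also have "norm \<dots> = (M + \<mu>) * \<mu>"
    using M assms(2) by (intro norm_flat_cone flat) auto
  finally have "M + \<mu> \<le> (2 * M + 4 * \<mu>) / 3" using assms(2) by simp
  then show False using M by simp
qed

text \<open>The parameters of minimizers form a compact set, so there is a last one,
  \<open>s\<close>. By convexity the norm is constant between \<open>p\<close> and \<open>s\<close>,
  and \<open>birkhoff_flat_extends\<close> produces a minimizer beyond \<open>s\<close>.\<close>

lemma birkhoff_minimizer_unique_aux:
  fixes x y :: "'a::real_normed_vector"
  assumes ib: "isosceles_imp_birkhoff TYPE('a)" and y: "y \<noteq> 0" and "\<mu> > 0"
    and min: "\<And>t. \<mu> \<le> norm (x + t *\<^sub>R y)"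
    and p: "norm (x + p *\<^sub>R y) = \<mu>" and q: "norm (x + q *\<^sub>R y) = \<mu>" and "p < q"
  shows False
proof -
  define S where "S = {t. norm (x + t *\<^sub>R y) = \<mu>}"
  have "closed S" unfolding S_def by (intro closed_Collect_eq continuous_intros)
  moreover have "\<bar>t\<bar> \<le> (\<mu> + norm x) / norm y" if "t \<in> S" for t
  proof -
    have "norm (t *\<^sub>R y) \<le> norm (x + t *\<^sub>R y) + norm x"
      using norm_triangle_ineq4[of "x + t *\<^sub>R y" x] by simp
    then show ?thesis using that y by (simp add: S_def field_simps)
  qed
  then have "bounded S" unfolding bounded_iff by auto
  ultimately have "compact S" by (simp add: compact_eq_bounded_closed)
  moreover have "q \<in> S" using q by (simp add: S_def)
  ultimately obtain s where s: "s \<in> S" "\<And>t. t \<in> S \<Longrightarrow> t \<le> s"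
    using compact_attains_sup[of S] by auto
  then have ps: "p < s" using \<open>p < q\<close> \<open>q \<in> S\<close> by force
  \<comment> \<open>Midpoint and half-length of the segment from \<open>p\<close> to
    \<open>s\<close>: the flat piece has parameters from -1 to 1, and 3/2 lies past
    \<open>s\<close>.\<close>
  define c h where "c = (p + s) / 2" and "h = (s - p) / 2"
  have h: "h > 0" using ps by (simp add: h_def)
  have shift: "x + c *\<^sub>R y + t *\<^sub>R (h *\<^sub>R y) = x + (c + t * h) *\<^sub>R y" for t
    by (simp add: algebra_simps)
  have flat: "norm (x + c *\<^sub>R y + t *\<^sub>R (h *\<^sub>R y)) = \<mu>" if t: "\<bar>t\<bar> \<le> 1" for t
  proof (rule antisym)
    have e: "x + (c + t * h) *\<^sub>R y =
        ((1 - t) / 2) *\<^sub>R (x + p *\<^sub>R y) + ((1 + t) / 2) *\<^sub>R (x + s *\<^sub>R y)" (is "_ = ?A + ?B")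
    proof -
      have "?A + ?B = ((1 - t) / 2 + (1 + t) / 2) *\<^sub>R x + ((1 - t) / 2 * p + (1 + t) / 2 * s) *\<^sub>R y"
        by (simp only: scaleR_right_distrib scaleR_left_distrib scaleR_scaleR) simp
      also have "(1 - t) / 2 + (1 + t) / 2 = 1" by (simp add: field_simps)
      also have "(1 - t) / 2 * p + (1 + t) / 2 * s = c + t * h"
        by (simp add: c_def h_def field_simps)
      finally show ?thesis by simp
    qed
    have "norm (x + (c + t * h) *\<^sub>R y) \<le> (1 - t) / 2 * \<mu> + (1 + t) / 2 * \<mu>"
      unfolding e using t p s(1) unfolding S_def
      by (intro order_trans[OF norm_triangle_ineq]) auto
    also have "\<dots> = \<mu>" by (simp add: field_simps)
    finally show "norm (x + c *\<^sub>R y + t *\<^sub>R (h *\<^sub>R y)) \<le> \<mu>" by (simp only: shift)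
    show "\<mu> \<le> norm (x + c *\<^sub>R y + t *\<^sub>R (h *\<^sub>R y))" unfolding shift by (rule min)
  qed
  have "norm (x + (c + 3/2 * h) *\<^sub>R y) \<le> \<mu>"
    using birkhoff_flat_extends[OF ib \<open>\<mu> > 0\<close> flat] unfolding shift by blast
  then have "c + 3/2 * h \<in> S" using min[of "c + 3/2 * h"] by (simp add: S_def)
  then have "c + 3/2 * h \<le> s" by (rule s)
  then show False using ps by (simp add: c_def h_def field_simps)
qed

lemma birkhoff_minimizer_unique:
  fixes x y :: "'a::real_normed_vector"
  assumes "isosceles_imp_birkhoff TYPE('a)" "\<And>t. x + t *\<^sub>R y \<noteq> 0" "y \<noteq> 0"
    and "\<And>t. norm (x + p *\<^sub>R y) \<le> norm (x + t *\<^sub>R y)"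
    and "\<And>t. norm (x + q *\<^sub>R y) \<le> norm (x + t *\<^sub>R y)"
  shows "p = q"
proof (rule ccontr)
  have eq: "norm (x + p *\<^sub>R y) = norm (x + q *\<^sub>R y)" using assms(4,5) by (intro antisym)
  have pos: "norm (x + p *\<^sub>R y) > 0" using assms(2) by simp
  assume "p \<noteq> q"
  then consider "p < q" | "q < p" by linarith
  then show False
  proof cases
    case 1
    show False
      by (rule birkhoff_minimizer_unique_aux[OF assms(1,3) pos assms(4) refl eq[symmetric] 1])
  next
    case 2
    show False
      by (rule birkhoff_minimizer_unique_aux[OF assms(1,3) pos assms(4) eq[symmetric] refl 2])
  qed
qed

section \<open>Reflections that are isometries\<close>

text \<open>If the value at \<open>-t\<close> were larger than at \<open>t\<close>, the intermediate
  value theorem would give \<open>s < t\<close> with the value at \<open>-s\<close> equal to that at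
  \<open>t\<close>. The midpoint \<open>p > 0\<close> of \<open>-s\<close> and \<open>t\<close>
  would then be a minimizer, besides 0.\<close>

lemma isosceles_homogeneous_aux:
  fixes x y :: "'a::real_normed_vector"
  assumes ib: "isosceles_imp_birkhoff TYPE('a)" and eq: "norm (x + y) = norm (x - y)"
    and nz: "\<And>t. x + t *\<^sub>R y \<noteq> 0" "y \<noteq> 0" and "t > 0"
  shows "norm (x - t *\<^sub>R y) \<le> norm (x + t *\<^sub>R y)"
proof (rule ccontr)
  have min: "norm x \<le> norm (x + u *\<^sub>R y)" for u
    using ib eq unfolding isosceles_imp_birkhoff_def by blast
  assume less: "\<not> norm (x - t *\<^sub>R y) \<le> norm (x + t *\<^sub>R y)"
  have "\<exists>s\<ge>0. s \<le> t \<and> norm (x - s *\<^sub>R y) = norm (x + t *\<^sub>R y)"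
    using less min[of t] \<open>t > 0\<close> by (intro IVT' continuous_intros) auto
  then obtain s where s: "0 \<le> s" "s \<le> t" "norm (x - s *\<^sub>R y) = norm (x + t *\<^sub>R y)" by blast
  then have st: "s < t" using less by (cases "s = t") auto
  define p r where "p = (t - s) / 2" and "r = (t + s) / 2"
  have r: "r > 0" using s \<open>t > 0\<close> by (simp add: r_def)
  have shift: "(x + p *\<^sub>R y) + r *\<^sub>R y = x + (p + r) *\<^sub>R y" "(x + p *\<^sub>R y) - r *\<^sub>R y = x - (r - p) *\<^sub>R y"
    by (simp_all add: algebra_simps)
  have pr: "p + r = t" "r - p = s" by (simp_all add: p_def r_def field_simps)
  have "norm ((x + p *\<^sub>R y) + r *\<^sub>R y) = norm ((x + p *\<^sub>R y) - r *\<^sub>R y)"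
    by (simp only: shift pr s(3))
  then have *: "norm (x + p *\<^sub>R y) \<le> norm (x + p *\<^sub>R y + u *\<^sub>R r *\<^sub>R y)" for u
    using ib unfolding isosceles_imp_birkhoff_def by blast
  have min': "norm (x + p *\<^sub>R y) \<le> norm (x + u *\<^sub>R y)" for u
    using *[of "(u - p) / r"] r by (simp add: scaleR_left_diff_distrib)
  have "p = 0" using birkhoff_minimizer_unique[OF ib nz min', of 0] min by simp
  then show False using st by (simp add: p_def)
qed

text \<open>The auxiliary inequality for \<open>y\<close> and for \<open>-y\<close> gives equality
  when the line misses the origin. If the line meets the origin and \<open>y\<close> is nonzero,
  \<open>x\<close> is a multiple of \<open>y\<close> and the hypothesis forces
  \<open>x = 0\<close>.\<close>

lemma isosceles_homogeneous:
  fixes x y :: "'a::real_normed_vector"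
  assumes ib: "isosceles_imp_birkhoff TYPE('a)" and eq: "norm (x + y) = norm (x - y)"
  shows "norm (p *\<^sub>R x + q *\<^sub>R y) = norm (p *\<^sub>R x - q *\<^sub>R y)"
proof -
  have pos: "norm (x + t *\<^sub>R y) = norm (x - t *\<^sub>R y)" if "t > 0" for t
  proof (cases "y = 0 \<or> (\<exists>u. x + u *\<^sub>R y = 0)")
    case True
    then consider "y = 0" | u where "y \<noteq> 0" "x = (- u) *\<^sub>R y"
      by (metis add_eq_0_iff2 scaleR_minus_left)
    then show ?thesis
    proof cases
      case 2
      have "x + y = (1 - u) *\<^sub>R y" "x - y = (- 1 - u) *\<^sub>R y"
        unfolding 2(2) by (simp_all add: algebra_simps)
      then have "\<bar>1 - u\<bar> * norm y = \<bar>- 1 - u\<bar> * norm y" using eq by (metis norm_scaleR)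
      then have "\<bar>1 - u\<bar> = \<bar>- 1 - u\<bar>" using 2(1) by simp
      then have "u = 0" by linarith
      then show ?thesis using 2(2) by simp
    qed simp
  next
    case False
    show ?thesis
    proof (rule antisym)
      have "x + v *\<^sub>R (- y) \<noteq> 0" for v
        using False by (metis scaleR_minus_left scaleR_minus_right)
      then show "norm (x + t *\<^sub>R y) \<le> norm (x - t *\<^sub>R y)"
        using isosceles_homogeneous_aux[OF ib _ _ _ that, of x "- y"] eq False by simp
      show "norm (x - t *\<^sub>R y) \<le> norm (x + t *\<^sub>R y)"
        using isosceles_homogeneous_aux[OF ib eq _ _ that] False by blast
    qed
  qed
  have all: "norm (x + t *\<^sub>R y) = norm (x - t *\<^sub>R y)" for t
    using pos[of t] pos[of "- t"] by (cases t "0 :: real" rule: linorder_cases) auto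
  show ?thesis
  proof (cases "p = 0")
    case False
    then have "p *\<^sub>R x + q *\<^sub>R y = p *\<^sub>R (x + (q / p) *\<^sub>R y)"
      "p *\<^sub>R x - q *\<^sub>R y = p *\<^sub>R (x - (q / p) *\<^sub>R y)" by (simp_all add: algebra_simps)
    then show ?thesis using all[of "q / p"] by simp
  qed simp
qed

text \<open>Equal norms of \<open>a\<close> and \<open>b\<close> make \<open>a + b\<close> and
  \<open>a - b\<close> isosceles orthogonal, and interchanging the coefficients of \<open>a\<close>
  and \<open>b\<close> only changes the sign of the coefficient of \<open>a - b\<close>.\<close>

lemma norm_swap:
  fixes a b :: "'a::real_normed_vector"
  assumes ib: "isosceles_imp_birkhoff TYPE('a)" and eq: "norm a = norm b"
  shows "norm (p *\<^sub>R a + q *\<^sub>R b) = norm (q *\<^sub>R a + p *\<^sub>R b)"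
proof -
  have "(a + b) + (a - b) = 2 *\<^sub>R a" "(a + b) - (a - b) = 2 *\<^sub>R b" by (simp_all add: scaleR_2)
  then have e: "norm ((a + b) + (a - b)) = norm ((a + b) - (a - b))" using eq by simp
  have "((u + v) / 2) *\<^sub>R (a + b) + ((u - v) / 2) *\<^sub>R (a - b) = u *\<^sub>R a + v *\<^sub>R b" for u v
  proof -
    have "((u + v) / 2) *\<^sub>R (a + b) + ((u - v) / 2) *\<^sub>R (a - b) =
       ((u + v) / 2 + (u - v) / 2) *\<^sub>R a + ((u + v) / 2 - (u - v) / 2) *\<^sub>R b"
      by (simp only: scaleR_right_distrib scaleR_right_diff_distrib scaleR_left_distrib
          scaleR_left_diff_distrib) simp
    also have "(u + v) / 2 + (u - v) / 2 = u" by (simp add: field_simps)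
    also have "(u + v) / 2 - (u - v) / 2 = v" by (simp add: field_simps)
    finally show ?thesis .
  qed
  note R = this
  have "((p + q) / 2) *\<^sub>R (a + b) - ((p - q) / 2) *\<^sub>R (a - b) = q *\<^sub>R a + p *\<^sub>R b"
    using R[of q p] by (simp add: add.commute minus_divide_left diff_conv_add_uminus
      flip: scaleR_minus_left del: add_uminus_conv_diff)
  then show ?thesis
    using isosceles_homogeneous[OF ib e, of "(p + q) / 2" "(p - q) / 2"] R[of p q] by simp
qed

section \<open>Recovering the inner product\<close>

text \<open>
  The isometry interchanging \<open>a\<close> and \<open>b = x a + y t\<close> maps \<open>t\<close> to \<open>w\<close>, so \<open>w\<close> is isosceles
  orthogonal to \<open>b\<close>; by the symmetries of the square with vertices \<open>\<plusminus>a, \<plusminus>t\<close>, so is the rotated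
  vector \<open>j = -y a + x t\<close>. Both therefore have the same distance from the line spanned by \<open>b\<close>.
\<close>

lemma unit_coordinates:
  fixes a t :: "'a::real_normed_vector"
  assumes ib: "isosceles_imp_birkhoff TYPE('a)" and unit: "norm a = 1" "norm t = 1"
    and iso: "norm (a + t) = norm (a - t)" and b: "norm (x *\<^sub>R a + y *\<^sub>R t) = 1"
  shows "x\<^sup>2 + y\<^sup>2 = 1"
proof (cases "y = 0")
  case True
  then show ?thesis using b unit by (simp add: power2_eq_1_iff abs_if split: if_splits)
next
  case False
  define b where "b = x *\<^sub>R a + y *\<^sub>R t"
  \<comment> \<open>Solving \<open>b = x a + y t\<close> for \<open>t\<close> and interchanging
    \<open>a\<close> and \<open>b\<close> gives the image of \<open>t\<close>.\<close>
  define w where "w = (1 / y) *\<^sub>R (a - x *\<^sub>R b)"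
  define j where "j = (- y) *\<^sub>R a + x *\<^sub>R t"
  define r where "r = x\<^sup>2 + y\<^sup>2"
  have r: "r > 0" using False by (simp add: r_def sum_power2_gt_zero_iff)
  have nb: "norm b = 1" using b by (simp add: b_def)
  note swap = norm_swap[OF ib] and neg = isosceles_homogeneous[OF ib iso]
  have ws: "norm (w + s *\<^sub>R b) = norm (t + s *\<^sub>R a)" for s
  proof -
    have "w + s *\<^sub>R b = (1 / y) *\<^sub>R (1 *\<^sub>R a + (s * y - x) *\<^sub>R b)"
      using False by (simp add: w_def algebra_simps)
    moreover have "t + s *\<^sub>R a = (1 / y) *\<^sub>R ((s * y - x) *\<^sub>R a + 1 *\<^sub>R b)"
      using False by (simp add: b_def algebra_simps)
    ultimately show ?thesis using swap[of a b 1 "s * y - x"] unit nb by simp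
  qed
  have nw: "norm w = 1" using ws[of 0] unit by simp
  have "norm (w + b) = norm (w - b)"
    using ws[of 1] ws[of "- 1"] iso by (simp add: add.commute norm_minus_commute)
  then have wb: "norm w \<le> norm (w + s *\<^sub>R b)" for s
    using ib unfolding isosceles_imp_birkhoff_def by blast
  have nj: "norm j = 1"
    using swap[of a t "- y" x] neg[of x y] unit nb by (simp add: j_def b_def)
  have "j + b = (x - y) *\<^sub>R a + (x + y) *\<^sub>R t" "j - b = (- (x + y)) *\<^sub>R a + (x - y) *\<^sub>R t"
    by (simp_all add: j_def b_def algebra_simps)
  moreover have "norm ((x - y) *\<^sub>R a + (x + y) *\<^sub>R t) = norm ((- (x + y)) *\<^sub>R a + (x - y) *\<^sub>R t)"
    using swap[of a t "- (x + y)" "x - y"] neg[of "x - y" "x + y"] unit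
    by (simp only: scaleR_minus_left add_uminus_conv_diff)
  ultimately have "norm (j + b) = norm (j - b)" by simp
  then have jb: "norm j \<le> norm (j + s *\<^sub>R b)" for s
    using ib unfolding isosceles_imp_birkhoff_def by blast
  \<comment> \<open>Chosen so that \<open>j\<close> = \<open>-r w\<close> + \<mu> \<open>b\<close>:
    indeed \<open>y j = -r a + x b\<close> and \<open>a = y w + x b\<close>. Each of
    \<open>j\<close> and \<open>w\<close> is shortest on its line parallel to \<open>b\<close>,
    which yields both inequalities between \<open>r\<close> and 1.\<close>
  define \<mu> where "\<mu> = (x - r * x) / y"
  have "y *\<^sub>R j = y *\<^sub>R ((- r) *\<^sub>R w + \<mu> *\<^sub>R b)"
  proof -
    have "y *\<^sub>R ((- r) *\<^sub>R w + \<mu> *\<^sub>R b) = (- r) *\<^sub>R (y *\<^sub>R w) + (y * \<mu>) *\<^sub>R b"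
      by (simp add: algebra_simps)
    also have "\<dots> = (- r) *\<^sub>R (a - x *\<^sub>R b) + (x - r * x) *\<^sub>R b"
      using False by (simp add: w_def \<mu>_def)
    also have "\<dots> = (- r) *\<^sub>R a + x *\<^sub>R b" by (simp add: algebra_simps)
    also have "\<dots> = y *\<^sub>R j"
      by (simp add: b_def j_def r_def algebra_simps power2_eq_square)
    finally show ?thesis by (rule sym)
  qed
  then have j: "j = (- r) *\<^sub>R w + \<mu> *\<^sub>R b" using False unfolding real_vector.scale_cancel_left by blast
  have "j = (- r) *\<^sub>R (w + (- \<mu> / r) *\<^sub>R b)" using r by (simp add: j algebra_simps)
  then have "1 = r * norm (w + (- \<mu> / r) *\<^sub>R b)" using nj r by (metis abs_minus_cancel abs_of_pos norm_scaleR)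
  then have "r \<le> 1" using wb[of "- \<mu> / r"] nw r
    by (metis mult.right_neutral mult_left_mono order_less_imp_le)
  have "j + (- \<mu>) *\<^sub>R b = (- r) *\<^sub>R w" by (simp add: j)
  then have "1 \<le> r" using jb[of "- \<mu>"] nw nj r by simp
  with \<open>r \<le> 1\<close> show ?thesis by (simp add: r_def)
qed

lemma dim_2_spanning_pair:
  assumes "dim (UNIV :: 'a::real_vector set) = 2"
  shows "\<exists>u v :: 'a. (\<forall>p q. p *\<^sub>R u + q *\<^sub>R v = 0 \<longrightarrow> p = 0 \<and> q = 0) \<and>
    (\<forall>z. \<exists>p q. z = p *\<^sub>R u + q *\<^sub>R v)"
proof -
  obtain B :: "'a set" where B: "independent B" "UNIV \<subseteq> span B" "card B = 2"
    using basis_exists[of "UNIV :: 'a set"] assms by metis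
  then obtain u v where uv: "B = {u, v}" "u \<noteq> v" by (meson card_2_iff)
  have ind: "p = 0 \<and> q = 0" if "p *\<^sub>R u + q *\<^sub>R v = 0" for p q
  proof -
    define f where "f z = (if z = u then p else q)" for z
    have "(\<Sum>z\<in>B. f z *\<^sub>R z) = 0" using that uv(2) unfolding uv(1) by (simp add: f_def)
    moreover have "finite B" "u \<in> B" "v \<in> B" by (simp_all add: uv(1))
    ultimately have "f u = 0" "f v = 0" using independentD[OF B(1) _ order_refl, of f] by blast+
    then show ?thesis using uv(2) by (simp add: f_def)
  qed
  moreover have "\<exists>p q. z = p *\<^sub>R u + q *\<^sub>R v" for z
  proof -
    have "z \<in> span {u, v}" using B(2) uv(1) by auto
    then obtain p where "z - p *\<^sub>R u \<in> span {v}" unfolding span_insert by blast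
    then obtain q where "z - p *\<^sub>R u = q *\<^sub>R v" unfolding span_singleton by blast
    then show ?thesis by (metis diff_eq_eq add.commute)
  qed
  ultimately show ?thesis by blast
qed

text \<open>The sum and difference of two independent unit vectors are isosceles orthogonal, and
  homogeneity preserves this when they are normalised to \<open>a\<close> and \<open>t\<close>. In
  these coordinates \<open>unit_coordinates\<close> makes the squared norm a sum of squares, so
  polarization gives an inner product.\<close>

lemma birkhoff_imp_euclidean:
  assumes dim: "dim (UNIV :: 'a::real_normed_vector set) = 2"
    and ib: "isosceles_imp_birkhoff TYPE('a)"
  shows "euclidean_norm (norm :: 'a \<Rightarrow> real)"
proof -
  obtain u v :: 'a where ind: "\<And>p q. p *\<^sub>R u + q *\<^sub>R v = 0 \<Longrightarrow> p = 0 \<and> q = 0"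
    and spn: "\<And>z. \<exists>p q. z = p *\<^sub>R u + q *\<^sub>R v"
    using dim_2_spanning_pair[OF dim] by blast
  have uv: "u \<noteq> 0" "v \<noteq> 0" using ind[of 1 0] ind[of 0 1] by auto
  define x y where "x = sgn u + sgn v" and "y = sgn u - sgn v"
  have sg: "sgn u = (1 / norm u) *\<^sub>R u" "sgn v = (1 / norm v) *\<^sub>R v" by (simp_all add: sgn_div_norm divide_inverse)
  have xy0: "x \<noteq> 0" "y \<noteq> 0"
    using ind[of "1 / norm u" "1 / norm v"] ind[of "1 / norm u" "- 1 / norm v"] uv
    by (auto simp: x_def y_def sg)
  have xy2: "x + y = 2 *\<^sub>R sgn u" "x - y = 2 *\<^sub>R sgn v" by (simp_all add: x_def y_def scaleR_2)
  then have "norm (x + y) = norm (x - y)" using uv by (simp add: norm_sgn)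
  note hom = isosceles_homogeneous[OF ib this]
  define a t where "a = (1 / norm x) *\<^sub>R x" and "t = (1 / norm y) *\<^sub>R y"
  have unit: "norm a = 1" "norm t = 1" using xy0 by (simp_all add: a_def t_def)
  have iso: "norm (a + t) = norm (a - t)" unfolding a_def t_def by (rule hom)
  have "\<exists>p q. z = p *\<^sub>R a + q *\<^sub>R t" for z
  proof -
    obtain p q where z: "z = p *\<^sub>R u + q *\<^sub>R v" using spn by blast
    define c d where "c = p * norm u / 2" and "d = q * norm v / 2"
    have "u = (norm u / 2) *\<^sub>R (x + y)" "v = (norm v / 2) *\<^sub>R (x - y)"
      using uv unfolding xy2 sg by simp_all
    then have "z = c *\<^sub>R (x + y) + d *\<^sub>R (x - y)" unfolding z c_def d_def by (metis scaleR_scaleR times_divide_eq_right)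
    also have "\<dots> = (c + d) *\<^sub>R x + (c - d) *\<^sub>R y" by (simp add: algebra_simps)
    also have "\<dots> = ((c + d) * norm x) *\<^sub>R a + ((c - d) * norm y) *\<^sub>R t"
      using xy0 by (simp add: a_def t_def)
    finally show ?thesis by blast
  qed
  note coords = this
  have N2: "(norm (p *\<^sub>R a + q *\<^sub>R t))\<^sup>2 = p\<^sup>2 + q\<^sup>2" for p q
  proof (cases "p *\<^sub>R a + q *\<^sub>R t = 0")
    case True
    have "q = 0"
    proof (rule ccontr)
      assume q: "q \<noteq> 0"
      define s where "s = - p / q"
      have "q *\<^sub>R t = q *\<^sub>R (s *\<^sub>R a)" using True q by (simp add: s_def add_eq_0_iff)
      then have t: "t = s *\<^sub>R a" using q by (simp only: real_vector.scale_cancel_left) simp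
      have "a + t = (1 + s) *\<^sub>R a" "a - t = (1 - s) *\<^sub>R a" by (simp_all add: t algebra_simps)
      then have "\<bar>1 + s\<bar> = \<bar>1 - s\<bar>" using iso unit by simp
      then have "s = 0" by linarith
      then show False using t unit by simp
    qed
    then show ?thesis using True unit by auto
  next
    case False
    define n where "n = norm (p *\<^sub>R a + q *\<^sub>R t)"
    have n: "n > 0" using False by (simp add: n_def)
    have "(p / n) *\<^sub>R a + (q / n) *\<^sub>R t = (1 / n) *\<^sub>R (p *\<^sub>R a + q *\<^sub>R t)"
      by (simp add: scaleR_right_distrib)
    then have "norm ((p / n) *\<^sub>R a + (q / n) *\<^sub>R t) = 1" using n by (simp add: n_def)
    from unit_coordinates[OF ib unit iso this]
    show ?thesis using n unfolding n_def[symmetric] by (simp add: field_simps power2_eq_square)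
  qed
  define ip where "ip z w = ((norm (z + w))\<^sup>2 - (norm (z - w))\<^sup>2) / 4" for z w :: 'a
  have ip: "ip (p *\<^sub>R a + q *\<^sub>R t) (p' *\<^sub>R a + q' *\<^sub>R t) = p * p' + q * q'" for p q p' q'
  proof -
    have "p *\<^sub>R a + q *\<^sub>R t + (p' *\<^sub>R a + q' *\<^sub>R t) = (p + p') *\<^sub>R a + (q + q') *\<^sub>R t"
      "p *\<^sub>R a + q *\<^sub>R t - (p' *\<^sub>R a + q' *\<^sub>R t) = (p - p') *\<^sub>R a + (q - q') *\<^sub>R t"
      by (simp_all add: algebra_simps)
    then show ?thesis
      unfolding ip_def by (simp only: N2) (simp add: power2_eq_square field_simps)
  qed
  have com: "ip z w = ip w z" for z w by (simp add: ip_def add.commute norm_minus_commute)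
  have nrm: "ip z z = (norm z)\<^sup>2" for z
    by (simp add: ip_def power_mult_distrib flip: scaleR_2)
  have lin: "linear (ip z)" for z
  proof (rule linearI)
    obtain p q where z: "z = p *\<^sub>R a + q *\<^sub>R t" using coords by blast
    fix w1 w2 :: 'a and c :: real
    obtain p1 q1 where w1: "w1 = p1 *\<^sub>R a + q1 *\<^sub>R t" using coords by blast
    obtain p2 q2 where w2: "w2 = p2 *\<^sub>R a + q2 *\<^sub>R t" using coords by blast
    have "w1 + w2 = (p1 + p2) *\<^sub>R a + (q1 + q2) *\<^sub>R t" "c *\<^sub>R w1 = (c * p1) *\<^sub>R a + (c * q1) *\<^sub>R t"
      by (simp_all add: w1 w2 algebra_simps)
    then show "ip z (w1 + w2) = ip z w1 + ip z w2" "ip z (c *\<^sub>R w1) = c *\<^sub>R ip z w1"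
      by (simp_all only: ip z) (simp_all add: w1 w2 ip algebra_simps)
  qed
  then have "bilinear ip" unfolding bilinear_def using com by (auto simp: com[of _ z for z])
  then have "inner_product_on_space ip"
    unfolding inner_product_on_space_def using com nrm by auto
  moreover have "norm z = sqrt (ip z z)" for z by (simp add: nrm)
  ultimately show ?thesis unfolding euclidean_norm_def by blast
qed

section \<open>Orthocentric systems with the fourth point on a bisector\<close>

text \<open>A vanishing combination has coefficients of equal absolute value, so it is a multiple of
  \<open>a + b\<close> or of \<open>a - b\<close>.\<close>

lemma unit_vectors_independent:
  fixes a b :: "'a::real_normed_vector"
  assumes "norm a = 1" "norm b = 1" "a \<noteq> b" "a + b \<noteq> 0" "p *\<^sub>R a + q *\<^sub>R b = 0"
  shows "p = 0 \<and> q = 0"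
proof -
  have e: "p *\<^sub>R a = - (q *\<^sub>R b)" using assms(5) by (simp add: add_eq_0_iff2)
  then have "norm (p *\<^sub>R a) = norm (q *\<^sub>R b)" by simp
  then have "\<bar>p\<bar> = \<bar>q\<bar>" using assms(1,2) by simp
  then consider "q = p" | "q = - p" by linarith
  then show ?thesis
  proof cases
    case 1
    then have "p *\<^sub>R (a + b) = 0" using e by (simp add: algebra_simps)
    then show ?thesis using 1 assms(4) by simp
  next
    case 2
    then have "p *\<^sub>R (a - b) = 0" using e by (simp add: algebra_simps)
    then show ?thesis using 2 assms(3) by simp
  qed
qed

text \<open>
  For \<open>c\<close> on the arc of the unit circle from \<open>-a\<close> to \<open>-b\<close>, the bisector at \<open>c\<close> changes sides
  with respect to \<open>a + b\<close>.
\<close>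

lemma bisector_parallel_to_sum:
  fixes a b :: "'a::real_normed_vector"
  assumes ab: "norm a = 1" "norm b = 1" "a \<noteq> b" "a + b \<noteq> 0"
  obtains \<alpha> \<beta> where "\<alpha> > 0" "\<beta> > 0" "norm (\<alpha> *\<^sub>R a + \<beta> *\<^sub>R b) = 1"
    "(1 + \<alpha> - \<beta>) / norm ((1 + \<alpha>) *\<^sub>R a + \<beta> *\<^sub>R b) =
     (1 + \<beta> - \<alpha>) / norm (\<alpha> *\<^sub>R a + (1 + \<beta>) *\<^sub>R b)"
proof -
  note ind = unit_vectors_independent[OF ab]
  define n where "n s = norm ((1 - s) *\<^sub>R a + s *\<^sub>R b)" for s
  have n: "n s \<noteq> 0" for s using ind[of "1 - s" s] by (auto simp: n_def)
  \<comment> \<open>Coordinates of \<open>-c\<close>, obtained by projecting the chord from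
    \<open>a\<close> to \<open>b\<close> radially onto the unit circle.\<close>
  define A B where "A s = (1 - s) / n s" and "B s = s / n s" for s
  have na: "norm ((1 + A s) *\<^sub>R a + B s *\<^sub>R b) \<noteq> 0" and nb: "norm (A s *\<^sub>R a + (1 + B s) *\<^sub>R b) \<noteq> 0"
    if "0 \<le> s" "s \<le> 1" for s
  proof -
    have "A s \<ge> 0" "B s \<ge> 0" using that by (auto simp: A_def B_def n_def)
    then show "norm ((1 + A s) *\<^sub>R a + B s *\<^sub>R b) \<noteq> 0" "norm (A s *\<^sub>R a + (1 + B s) *\<^sub>R b) \<noteq> 0"
      using ind[of "1 + A s" "B s"] ind[of "A s" "1 + B s"] by auto
  qed
  \<comment> \<open>For \<open>c = -(A a + B b)\<close>, this is the coefficient of \<open>b\<close>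
    minus that of \<open>a\<close> in the sum of the unit vectors along \<open>a - c\<close> and
    \<open>b - c\<close>; it vanishes when the bisector is parallel to \<open>a + b\<close>.\<close>
  define g where "g s = (1 + B s - A s) / norm (A s *\<^sub>R a + (1 + B s) *\<^sub>R b) -
    (1 + A s - B s) / norm ((1 + A s) *\<^sub>R a + B s *\<^sub>R b)" for s
  have cn: "continuous_on {0..1} n" unfolding n_def by (intro continuous_intros)
  have cA: "continuous_on {0..1} A" "continuous_on {0..1} B"
    unfolding A_def B_def using n by (auto intro!: continuous_intros cn)
  have "continuous_on {0..1} g"
    unfolding g_def using na nb by (intro continuous_intros cA) auto
  moreover have n01: "n 0 = 1" "n 1 = 1" using ab by (simp_all add: n_def)
  have g01: "g 0 = - 1" "g 1 = 1"
    using ab by (simp_all add: g_def A_def B_def n01 flip: scaleR_2)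
  ultimately obtain s where s: "0 \<le> s" "s \<le> 1" "g s = 0"
    using IVT'[of g 0 0 1] by auto
  then have s01: "0 < s" "s < 1" using g01 by (auto simp: less_le)
  have np: "n s > 0" using n[of s] by (simp add: n_def)
  show ?thesis
  proof (rule that)
    show "A s > 0" "B s > 0" using s01 np by (auto simp: A_def B_def)
    have "A s *\<^sub>R a + B s *\<^sub>R b = (1 / n s) *\<^sub>R ((1 - s) *\<^sub>R a + s *\<^sub>R b)"
      by (simp add: A_def B_def scaleR_right_distrib)
    then show "norm (A s *\<^sub>R a + B s *\<^sub>R b) = 1" using np by (simp add: n_def)
    show "(1 + A s - B s) / norm ((1 + A s) *\<^sub>R a + B s *\<^sub>R b) =
      (1 + B s - A s) / norm (A s *\<^sub>R a + (1 + B s) *\<^sub>R b)"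
      using s(3) by (simp add: g_def)
  qed
qed

lemma equal_sides_imp_bisecting:
  fixes a b :: "'a::real_normed_vector"
  assumes H: "\<And>p1 p2 p3 p4 :: 'a. C_orthocentric_system {p1, p2, p3, p4} \<Longrightarrow>
      \<not> collinear {p1, p2, p3} \<Longrightarrow> p4 \<in> affine hull (busemann_bisector p3 p1 p2) \<Longrightarrow>
      norm (p3 - p1) = norm (p3 - p2)"
    and ab: "norm a = 1" "norm b = 1" "a + b \<noteq> 0"
  shows "norm (a + (a + b) /\<^sub>R norm (a + b)) = norm (b + (a + b) /\<^sub>R norm (a + b))"
proof (cases "a = b")
  case False
  note ind = unit_vectors_independent[OF ab(1,2) False ab(3)]
  obtain \<alpha> \<beta> where pos: "\<alpha> > 0" "\<beta> > 0" and unit: "norm (\<alpha> *\<^sub>R a + \<beta> *\<^sub>R b) = 1"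
    and eq: "(1 + \<alpha> - \<beta>) / norm ((1 + \<alpha>) *\<^sub>R a + \<beta> *\<^sub>R b) =
     (1 + \<beta> - \<alpha>) / norm (\<alpha> *\<^sub>R a + (1 + \<beta>) *\<^sub>R b)"
    using bisector_parallel_to_sum[OF ab(1,2) False ab(3)] by blast
  define c where "c = - (\<alpha> *\<^sub>R a + \<beta> *\<^sub>R b)"
  have ac: "a - c = (1 + \<alpha>) *\<^sub>R a + \<beta> *\<^sub>R b" and bc: "b - c = \<alpha> *\<^sub>R a + (1 + \<beta>) *\<^sub>R b"
    by (simp_all add: c_def algebra_simps)
  have nc: "norm c = 1" using unit by (simp only: c_def norm_minus_cancel)
  have "a - c \<noteq> 0" "b - c \<noteq> 0" unfolding ac bc
    using ind[of "1 + \<alpha>" \<beta>] ind[of \<alpha> "1 + \<beta>"] pos by auto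
  then have n: "norm (a - c) > 0" "norm (b - c) > 0" by simp_all
  \<comment> \<open>The orthocenter \<open>a + b + c\<close> coincides with a vertex exactly when
    the sum of the other two vanishes.\<close>
  have "a + c \<noteq> 0" "b + c \<noteq> 0"
    using ind[of "1 - \<alpha>" "- \<beta>"] ind[of "- \<alpha>" "1 - \<beta>"] pos by (auto simp: c_def algebra_simps)
  then have dist: "card {a, b, c, a + b + c} = 4"
    using \<open>a - c \<noteq> 0\<close> \<open>b - c \<noteq> 0\<close> False ab(3) by (auto simp: card_insert_if add_eq_0_iff)
  have "0 \<in> circumcenters a b c" using ab nc by (simp add: circumcenters_def)
  moreover have "a + b + c = C_orthocenter a b c 0" by (simp add: C_orthocenter_eq)
  moreover have "{a, b, c, a + b + c} = {a + b + c, a, b, c}" by auto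
  ultimately have sys: "C_orthocentric_system {a, b, c, a + b + c}"
    unfolding C_orthocentric_system_def using dist by blast
  have ncol: "\<not> collinear {a, b, c}"
  proof
    assume "collinear {a, b, c}"
    then obtain u k l where k: "a - c = k *\<^sub>R u" "b - c = l *\<^sub>R u" unfolding collinear_def by blast
    have "l *\<^sub>R (a - c) - k *\<^sub>R (b - c) = 0" by (simp add: k)
    then have "(l * (1 + \<alpha>) - k * \<alpha>) *\<^sub>R a + (l * \<beta> - k * (1 + \<beta>)) *\<^sub>R b = 0"
      unfolding ac bc by (simp add: algebra_simps)
    from ind[OF this] have e: "l * (1 + \<alpha>) = k * \<alpha>" "l * \<beta> = k * (1 + \<beta>)" by simp_all
    have "l * (1 + \<alpha> + \<beta>) = 0" using e by algebra
    moreover have "1 + \<alpha> + \<beta> \<noteq> 0" using pos by linarith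
    ultimately have "l = 0" by simp
    then show False using \<open>b - c \<noteq> 0\<close> k by simp
  qed
  have expand: "p *\<^sub>R (q *\<^sub>R a + r *\<^sub>R b) + p' *\<^sub>R (q' *\<^sub>R a + r' *\<^sub>R b) =
      (p * q + p' * q') *\<^sub>R a + (p * r + p' * r') *\<^sub>R b" for p q r p' q' r'
    by (simp add: algebra_simps)
  \<comment> \<open>The coefficient of \<open>a\<close> in the bisector direction; the choice of
    \<open>c\<close> makes it also the coefficient of \<open>b\<close>.\<close>
  define \<kappa> where "\<kappa> = (1 + \<alpha>) / norm (a - c) + \<alpha> / norm (b - c)"
  have l: "\<kappa> > 0" using pos n by (simp add: \<kappa>_def add_pos_pos)
  have l': "\<kappa> = \<beta> / norm (a - c) + (1 + \<beta>) / norm (b - c)"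
    using eq unfolding \<kappa>_def ac bc by (simp add: diff_divide_distrib add_divide_distrib)
  have "(a - c) /\<^sub>R norm (a - c) + (b - c) /\<^sub>R norm (b - c) =
      (1 / norm (a - c)) *\<^sub>R ((1 + \<alpha>) *\<^sub>R a + \<beta> *\<^sub>R b) + (1 / norm (b - c)) *\<^sub>R (\<alpha> *\<^sub>R a + (1 + \<beta>) *\<^sub>R b)"
    by (simp only: ac bc inverse_eq_divide)
  also have "\<dots> = \<kappa> *\<^sub>R a + (\<beta> / norm (a - c) + (1 + \<beta>) / norm (b - c)) *\<^sub>R b"
    by (simp only: expand \<kappa>_def times_divide_eq_left mult_1_left)
  also have "\<dots> = \<kappa> *\<^sub>R (a + b)" by (simp only: l'[symmetric] scaleR_right_distrib)
  finally have dir: "(a - c) /\<^sub>R norm (a - c) + (b - c) /\<^sub>R norm (b - c) = \<kappa> *\<^sub>R (a + b)" .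
  have "a + b + c = c + (2 / \<kappa>) *\<^sub>R ((c + (1/2) *\<^sub>R \<kappa> *\<^sub>R (a + b)) - c)" using l by simp
  moreover have "2 / \<kappa> \<ge> 0" using l by simp
  ultimately have "a + b + c \<in> busemann_bisector c a b"
    unfolding busemann_bisector_def ray_def dir by blast
  then have "norm (c - a) = norm (c - b)" using H[OF sys ncol] by (simp add: hull_inc)
  then have eqn: "norm (a - c) = norm (b - c)" by (simp add: norm_minus_commute)
  \<comment> \<open>The two denominators in \<open>eq\<close> are now equal, hence so are the
    numerators, and \<open>c\<close> is the negative of the normalised sum.\<close>
  then have "1 + \<alpha> - \<beta> = 1 + \<beta> - \<alpha>" using eq n unfolding ac[symmetric] bc[symmetric] by simp
  then have [simp]: "\<beta> = \<alpha>" by simp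
  have c: "c = - (\<alpha> *\<^sub>R (a + b))" by (simp add: c_def algebra_simps)
  have "\<alpha> * norm (a + b) = 1" using nc pos unfolding c by simp
  then have "\<alpha> = inverse (norm (a + b))" by (metis inverse_unique mult.commute inverse_inverse_eq)
  then show ?thesis using eqn unfolding c by simp
qed simp

section \<open>Equal sides in the Euclidean case\<close>

text \<open>
  The configuration is symmetric in its four points: with \<open>s\<close> half their sum, the circumcenter
  associated with \<open>p\<close> is \<open>s - p\<close>.
\<close>

lemma C_orthocentric_system_equal_norms:
  assumes sys: "C_orthocentric_system {p1, p2, p3, p4}"
  defines "s \<equiv> (1/2) *\<^sub>R (p1 + p2 + p3 + p4)"
  shows "norm (s - p4 - p1) = norm (s - p4 - p2)" and "p3 \<noteq> p4"
proof -
  let ?P = "{p1, p2, p3, p4}"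
  obtain a b c d x where P: "?P = {a, b, c, d}" and x: "x \<in> circumcenters b c d"
    "a = C_orthocenter b c d x" and card: "card ?P = 4"
    using sys unfolding C_orthocentric_system_def by blast
  have dp: "distinct [p1, p2, p3, p4]" and da: "distinct [a, b, c, d]"
    using card P by (intro card_distinct; simp)+
  then show "p3 \<noteq> p4" by simp
  have "(\<Sum>z\<in>?P. z) = p1 + p2 + p3 + p4" using dp by (simp add: add.assoc)
  moreover have "(\<Sum>z\<in>{a, b, c, d}. z) = a + b + c + d" using da by (simp add: add.assoc)
  ultimately have "2 *\<^sub>R s = a + b + c + d" using P by (simp add: s_def)
  also have "\<dots> = 2 *\<^sub>R (b + c + d - x)"
    using x(2) by (simp add: C_orthocenter_eq algebra_simps scaleR_2)
  finally have s: "s = b + c + d - x" by simp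
  have a: "a = b + c + d - x - x" using x(2) by (simp add: C_orthocenter_eq scaleR_2 algebra_simps)
  define r where "r = norm (x - b)"
  have r: "norm (x - b) = r" "norm (x - c) = r" "norm (x - d) = r"
    using x(1) by (simp_all add: circumcenters_def r_def)
  then have r': "norm (b - x) = r" "norm (c - x) = r" "norm (d - x) = r"
    by (simp_all add: norm_minus_commute)
  \<comment> \<open>Here \<open>s - a = x\<close>, while for two of \<open>b\<close>,
    \<open>c\<close>, \<open>d\<close> subtracting both from \<open>s\<close> leaves the third minus
    \<open>x\<close>.\<close>
  have all: "norm (s - p - q) = r" if "p \<in> {a, b, c, d}" "q \<in> {a, b, c, d}" "p \<noteq> q" for p q
  proof -
    have "norm (s - a - b) = r" "norm (s - b - a) = r" "norm (s - a - c) = r"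
      "norm (s - c - a) = r" "norm (s - a - d) = r" "norm (s - d - a) = r"
      "norm (s - b - c) = r" "norm (s - c - b) = r" "norm (s - b - d) = r"
      "norm (s - d - b) = r" "norm (s - c - d) = r" "norm (s - d - c) = r"
      using r r' by (simp_all add: s a)
    then show ?thesis using that by blast
  qed
  have mem: "p1 \<in> {a, b, c, d}" "p2 \<in> {a, b, c, d}" "p4 \<in> {a, b, c, d}"
    unfolding P[symmetric] by simp_all
  have "p4 \<noteq> p1" "p4 \<noteq> p2" using dp by auto
  then show "norm (s - p4 - p1) = norm (s - p4 - p2)"
    using all[OF mem(3,1)] all[OF mem(3,2)] by simp
qed

lemma affine_hull_ray_subset:
  "affine hull (ray x y) \<subseteq> {x + t *\<^sub>R (y - x) | t. True}"
proof (rule hull_minimal)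
  show "affine {x + t *\<^sub>R (y - x) | t. True}"
    unfolding affine_def
  proof (clarsimp)
    fix s t u v :: real
    assume "u + v = 1"
    then have "u *\<^sub>R x + v *\<^sub>R x = x" by (simp flip: scaleR_left_distrib)
    then have "u *\<^sub>R (x + s *\<^sub>R (y - x)) + v *\<^sub>R (x + t *\<^sub>R (y - x)) = x + (u * s + v * t) *\<^sub>R (y - x)"
      by (simp add: scaleR_right_distrib scaleR_left_distrib)
    then show "\<exists>w. u *\<^sub>R (x + s *\<^sub>R (y - x)) + v *\<^sub>R (x + t *\<^sub>R (y - x)) = x + w *\<^sub>R (y - x)" by blast
  qed
qed (auto simp: ray_def)

text \<open>In the Euclidean case \<open>p4 - p3\<close> is orthogonal to \<open>p1 - p2\<close>, as
  for the classical orthocenter. If it is also along the bisector, the bisector is an altitude and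
  the triangle is isosceles.\<close>

lemma euclidean_imp_equal_sides:
  fixes p1 p2 p3 p4 :: "'a::real_normed_vector"
  assumes euc: "euclidean_norm (norm :: 'a \<Rightarrow> real)"
    and sys: "C_orthocentric_system {p1, p2, p3, p4}"
    and ncol: "\<not> collinear {p1, p2, p3}"
    and p4: "p4 \<in> affine hull (busemann_bisector p3 p1 p2)"
  shows "norm (p3 - p1) = norm (p3 - p2)"
proof -
  obtain ip where bil: "bilinear ip" and com: "\<And>x y. ip x y = ip y x"
    and pos: "\<And>x. x \<noteq> 0 \<Longrightarrow> ip x x > 0" and nrm: "\<And>x :: 'a. norm x = sqrt (ip x x)"
    using euc unfolding euclidean_norm_def inner_product_on_space_def by blast
  note bl = bilinear_ladd[OF bil] bilinear_radd[OF bil] bilinear_lsub[OF bil] bilinear_rsub[OF bil]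
    bilinear_lmul[OF bil] bilinear_rmul[OF bil]
  have sq: "ip x x = (norm x)\<^sup>2" for x
    using pos[of x] bilinear_lzero[OF bil] by (cases "x = 0") (auto simp: nrm)
  define s where "s = (1/2) *\<^sub>R (p1 + p2 + p3 + p4)"
  \<comment> \<open>Position vectors of \<open>p1\<close> and \<open>p2\<close> relative to
    \<open>s - p4\<close>, the circumcenter associated with \<open>p4\<close>.\<close>
  define A B where "A = p1 - (s - p4)" and "B = p2 - (s - p4)"
  have "norm A = norm B" and ne: "p3 \<noteq> p4"
    using C_orthocentric_system_equal_norms[OF sys]
    by (simp_all add: A_def B_def s_def norm_minus_commute)
  then have "ip (A + B) (A - B) = 0" by (simp add: bl sq com[of B A])
  moreover have "A + B = p4 - p3"
  proof -
    have "s + s = p1 + p2 + p3 + p4" by (simp add: s_def flip: scaleR_2)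
    moreover have "A + B = p1 + p2 + p4 + p4 - (s + s)" by (simp add: A_def B_def)
    ultimately show ?thesis by simp
  qed
  moreover have "A - B = p1 - p2" by (simp add: A_def B_def)
  ultimately have orth: "ip (p4 - p3) (p1 - p2) = 0" by simp
  define u v where "u = p1 - p3" and "v = p2 - p3"
  have uv0: "u \<noteq> 0" "v \<noteq> 0" using ncol by (auto simp: u_def v_def insert_commute)
  define d where "d = u /\<^sub>R norm u + v /\<^sub>R norm v"
  obtain t where t: "p4 - p3 = t *\<^sub>R d"
  proof -
    have "p4 \<in> {p3 + t *\<^sub>R (p3 + (1/2) *\<^sub>R d - p3) | t. True}"
      using p4 affine_hull_ray_subset unfolding busemann_bisector_def d_def u_def v_def by blast
    then obtain t where "p4 = p3 + t *\<^sub>R ((1/2) *\<^sub>R d)" by auto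
    then have "p4 - p3 = (t / 2) *\<^sub>R d" by simp
    then show ?thesis by (rule that)
  qed
  \<comment> \<open>Distinctness of the four points enters here: with \<open>p4 = p3\<close> the
    orthogonality would say nothing about \<open>d\<close>.\<close>
  then have "t \<noteq> 0" using ne by auto
  then have "ip d (u - v) = 0" using orth unfolding t by (simp add: bl u_def v_def)
  define x y where "x = norm u" and "y = norm v"
  define k where "k = ip u v"
  have xy: "x > 0" "y > 0" using uv0 by (simp_all add: x_def y_def)
  have "inverse x * (x\<^sup>2 - k) + inverse y * (k - y\<^sup>2) = 0"
    using \<open>ip d (u - v) = 0\<close> unfolding d_def
    by (simp add: bl sq com[of v u] flip: x_def y_def k_def) (simp add: algebra_simps)
  then have "(x - y) * (x * y + k) = 0" using xy by (simp add: field_simps power2_eq_square)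
  \<comment> \<open>Equality in the Cauchy-Schwarz inequality would make \<open>u\<close> and
    \<open>v\<close> opposite in direction, hence the three points collinear.\<close>
  moreover have "x * y + k \<noteq> 0"
  proof
    assume k: "x * y + k = 0"
    define z where "z = y *\<^sub>R u + x *\<^sub>R v"
    have "ip z z = 2 * x * y * (x * y + k)"
      unfolding z_def
      by (simp add: bl sq[of u] sq[of v] com[of v u] flip: x_def y_def k_def)
        (simp add: algebra_simps power2_eq_square)
    then have "z = 0" using k pos[of z] by (cases "z = 0") auto
    then have "y *\<^sub>R u = - (x *\<^sub>R v)" by (simp add: z_def add_eq_0_iff2)
    then have "y *\<^sub>R u = y *\<^sub>R ((- x / y) *\<^sub>R v)" using xy by simp
    then have u: "u = (- x / y) *\<^sub>R v" using xy by (simp only: real_vector.scale_cancel_left) simp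
    have "p1 = p3 + (- x / y) *\<^sub>R v" "p2 = p3 + 1 *\<^sub>R v" "p3 = p3 + 0 *\<^sub>R v"
      using u by (simp_all add: u_def v_def algebra_simps)
    then have "collinear {p1, p2, p3}" unfolding collinear_alt by blast
    then show False using ncol by simp
  qed
  ultimately have "x = y" by simp
  then show ?thesis by (simp add: x_def y_def u_def v_def norm_minus_commute)
qed

theorem theorem3p10:
  assumes "dim (UNIV :: 'a::real_normed_vector set) = 2"
  shows "euclidean_norm (norm :: 'a \<Rightarrow> real) \<longleftrightarrow>
    (\<forall>p1 p2 p3 p4 :: 'a.
       C_orthocentric_system {p1, p2, p3, p4} \<and>
       \<not> collinear {p1, p2, p3} \<and>
       p4 \<in> affine hull (busemann_bisector p3 p1 p2) \<longrightarrow>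
       norm (p3 - p1) = norm (p3 - p2))"
  (is "?E \<longleftrightarrow> ?H")
proof
  assume ?E
  then show ?H using euclidean_imp_equal_sides by blast
next
  assume H: ?H
  have "bisecting_property TYPE('a)"
    unfolding bisecting_property_def by (intro allI impI equal_sides_imp_bisecting) (use H in blast)
  then show ?E by (intro birkhoff_imp_euclidean assms isosceles_imp_birkhoff_if_bisecting)
qed

end
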